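(* Let $N = q^k n^2$ be an odd perfect number, where $q$ is a prime with $q \equiv k \equiv 1 \pmod 4$ and $\gcd(q,n)=1$. Then $$I(n^2) = 2 - \frac{5}{3q}$$ holds if and only if $k=1$ and $q=5$.
   Context: For a positive integer $N$, $\sigma(N)$ denotes the sum of the positive divisors of $N$; $N$ is perfect if $\sigma(N)=2N$. The abundancy index of a positive integer $w$ is $I(w)=\sigma(w)/w$. Euler showed every odd perfect number can be written as $q^k n^2$ with $q$ prime, $q \equiv k \equiv 1 \pmod 4$, and $\gcd(q,n)=1$; such $q$ is called the Euler prime. *)

theory Defs
  imports Complex_Main "HOL-Number_Theory.Number_Theory"
begin

definition divisor_sigma :: "nat \<Rightarrow> nat" where
  "divisor_sigma N = (\<Sum>d | d dvd N. d)"

(* Positivity is explicit: the divisor set of 0 is infinite, so divisor_sigma 0 = 0. *)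
definition perfect :: "nat \<Rightarrow> bool" where
  "perfect N \<longleftrightarrow> N > 0 \<and> divisor_sigma N = 2 * N"

definition abundancy :: "nat \<Rightarrow> real" where
  "abundancy w = real (divisor_sigma w) / real w"

end

theory Submission
  imports Defs
begin

text \<open>
  Write \<open>s = \<sigma>(q\<^sup>k)\<close>. Since \<open>I\<close> is multiplicative, perfection of \<open>q\<^sup>k n\<^sup>2\<close> gives
  \<open>I(n\<^sup>2) = 2 q\<^sup>k / s\<close>, and \<open>q s + 1 = s + q\<^sup>k\<^sup>+\<^sup>1\<close> turns this into
  \<open>I(n\<^sup>2) = 2 - 2 (s - 1) / (q s)\<close>. The right-hand side equals \<open>2 - 5 / (3 q)\<close> exactly when
  \<open>s = 6\<close>. As \<open>s - 1\<close> is a multiple of \<open>q\<close> for \<open>k > 0\<close>, it can only be the prime 5 if \<open>q = 5\<close>,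
  and then \<open>k = 1\<close>.
\<close>

lemma bij_betw_mult_divisors_coprime:
  fixes a b :: nat
  assumes "coprime a b"
  shows "bij_betw (\<lambda>(x, y). x * y) ({x. x dvd a} \<times> {y. y dvd b}) {d. d dvd a * b}"
proof (rule bij_betw_imageI)
  show "inj_on (\<lambda>(x, y). x * y) ({x. x dvd a} \<times> {y. y dvd b})"
  proof (rule inj_onI, clarify)
    fix x y x' y'
    assume dvds: "x dvd a" "y dvd b" "x' dvd a" "y' dvd b" and eq: "x * y = x' * y'"
    have "coprime x y'" "coprime x' y"
      using assms dvds by (meson coprime_divisors)+
    then show "x = x' \<and> y = y'"
      using eq by (simp add: coprime_crossproduct_nat)
  qed
  show "(\<lambda>(x, y). x * y) ` ({x. x dvd a} \<times> {y. y dvd b}) = {d. d dvd a * b}"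
    by (force simp: mult_dvd_mono dest: division_decomp)
qed

lemma divisor_sigma_mult_coprime:
  assumes "coprime a b"
  shows "divisor_sigma (a * b) = divisor_sigma a * divisor_sigma b"
proof -
  have "divisor_sigma (a * b) = (\<Sum>(x, y)\<in>{x. x dvd a} \<times> {y. y dvd b}. x * y)"
    unfolding divisor_sigma_def
    using sum.reindex_bij_betw[OF bij_betw_mult_divisors_coprime[OF assms], of "\<lambda>d. d"]
    by (simp add: case_prod_unfold)
  also have "\<dots> = divisor_sigma a * divisor_sigma b"
    by (simp add: divisor_sigma_def sum_product sum.cartesian_product)
  finally show ?thesis .
qed

lemma divisor_sigma_prime_power:
  assumes "prime p"
  shows "divisor_sigma (p ^ k) = (\<Sum>i\<le>k. p ^ i)"
proof -
  have "inj_on (\<lambda>i. p ^ i) {..k}"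
    using prime_gt_1_nat[OF assms] by (auto intro: inj_onI)
  moreover have "{d. d dvd p ^ k} = (\<lambda>i. p ^ i) ` {..k}"
    using assms by (auto simp: divides_primepow_nat)
  ultimately show ?thesis
    by (simp add: divisor_sigma_def sum.reindex)
qed

lemma divisor_sigma_prime_power_Suc:
  assumes "prime p"
  shows "divisor_sigma (p ^ Suc k) = divisor_sigma (p ^ k) + p ^ Suc k"
  by (simp only: divisor_sigma_prime_power[OF assms] sum.atMost_Suc)

lemma divisor_sigma_prime_power_Suc_shift:
  assumes "prime p"
  shows "divisor_sigma (p ^ Suc k) = 1 + p * divisor_sigma (p ^ k)"
  unfolding divisor_sigma_prime_power[OF assms] sum.atMost_Suc_shift
  by (simp add: sum_distrib_left)

lemma divisor_sigma_pos:
  assumes "m > 0"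
  shows "divisor_sigma m > 0"
  using assms by (auto simp: divisor_sigma_def intro!: sum_pos2[of _ m])

lemma divisor_sigma_prime_power_eq_1_iff:
  assumes "prime p"
  shows "divisor_sigma (p ^ k) = 1 \<longleftrightarrow> k = 0"
proof (cases k)
  case 0
  then show ?thesis
    by (simp add: divisor_sigma_def)
next
  case (Suc j)
  then show ?thesis
    using divisor_sigma_pos[of "p ^ j"] prime_gt_0_nat[OF assms]
    by (simp add: divisor_sigma_prime_power_Suc_shift[OF assms] del: power_Suc)
qed

lemma divisor_sigma_prime_power_eq_Suc_prime_iff:
  assumes "prime q" and "prime p"
  shows "divisor_sigma (q ^ k) = Suc p \<longleftrightarrow> k = 1 \<and> q = p"
proof (cases k)
  case 0
  then show ?thesis
    using prime_gt_0_nat[OF \<open>prime p\<close>] by (simp add: divisor_sigma_def)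
next
  case (Suc j)
  have "divisor_sigma (q ^ k) = Suc p \<longleftrightarrow> q * divisor_sigma (q ^ j) = p"
    by (simp add: Suc divisor_sigma_prime_power_Suc_shift[OF \<open>prime q\<close>] del: power_Suc)
  also have "\<dots> \<longleftrightarrow> divisor_sigma (q ^ j) = 1 \<and> q = p"
    using assms prime_product[of q "divisor_sigma (q ^ j)"] by auto
  also have "\<dots> \<longleftrightarrow> k = 1 \<and> q = p"
    unfolding divisor_sigma_prime_power_eq_1_iff[OF \<open>prime q\<close>] by (simp add: Suc)
  finally show ?thesis .
qed

lemma abundancy_mult_coprime:
  assumes "coprime a b"
  shows "abundancy (a * b) = abundancy a * abundancy b"
  by (simp add: abundancy_def divisor_sigma_mult_coprime[OF assms])

lemma perfect_iff_abundancy: "perfect N \<longleftrightarrow> abundancy N = 2"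
proof (cases "N = 0")
  case False
  then have "abundancy N = 2 \<longleftrightarrow> real (divisor_sigma N) = real (2 * N)"
    by (simp add: abundancy_def field_simps)
  also have "\<dots> \<longleftrightarrow> perfect N"
    using False by (simp only: of_nat_eq_iff perfect_def) simp
  finally show ?thesis ..
qed (simp add: perfect_def abundancy_def)

lemma inverse_abundancy_prime_power:
  fixes p k :: nat
  defines "s \<equiv> real (divisor_sigma (p ^ k))"
  assumes "prime p"
  shows "inverse (abundancy (p ^ k)) = 1 - (s - 1) / (real p * s)"
proof -
  have "p > 0"
    using \<open>prime p\<close> by (rule prime_gt_0_nat)
  then have "s > 0"
    by (simp add: s_def divisor_sigma_pos)
  have "1 + p * divisor_sigma (p ^ k) = divisor_sigma (p ^ k) + p ^ Suc k"
    by (simp only: flip: divisor_sigma_prime_power_Suc[OF \<open>prime p\<close>]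
        divisor_sigma_prime_power_Suc_shift[OF \<open>prime p\<close>])
  then have "real (1 + p * divisor_sigma (p ^ k)) = real (divisor_sigma (p ^ k) + p ^ Suc k)"
    by (rule arg_cong)
  then have "1 + real p * s = s + real p * real p ^ k"
    by (simp add: s_def)
  moreover have "inverse (abundancy (p ^ k)) = real p ^ k / s"
    by (simp add: abundancy_def s_def)
  ultimately show ?thesis
    using \<open>p > 0\<close> \<open>s > 0\<close> by (simp add: field_simps)
qed

lemma abundancy_cofactor_perfect:
  fixes q k m :: nat
  defines "s \<equiv> real (divisor_sigma (q ^ k))"
  assumes "perfect (q ^ k * m)" and "prime q" and "coprime q m"
  shows "abundancy m = 2 - 2 * (s - 1) / (real q * s)"
proof -
  have "abundancy (q ^ k) * abundancy m = 2"
    using \<open>perfect (q ^ k * m)\<close> \<open>coprime q m\<close>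
    by (simp add: perfect_iff_abundancy abundancy_mult_coprime)
  then have "abundancy m = 2 * inverse (abundancy (q ^ k))"
    by (cases "abundancy (q ^ k) = 0") (simp_all add: field_simps)
  then show ?thesis
    by (simp add: inverse_abundancy_prime_power[OF \<open>prime q\<close>] s_def)
qed

theorem theorem1:
  fixes N q k n :: nat
  assumes "N = q ^ k * n\<^sup>2"
    and "odd N" and "perfect N"
    and "prime q"
    and "[q = 1] (mod 4)" and "[k = 1] (mod 4)"
    and "coprime q n"
  shows "abundancy (n\<^sup>2) = 2 - 5 / (3 * real q) \<longleftrightarrow> k = 1 \<and> q = 5"
proof -
  define s where "s = divisor_sigma (q ^ k)"
  have "q > 0"
    using \<open>prime q\<close> by (rule prime_gt_0_nat)
  then have "s > 0"
    by (simp add: s_def divisor_sigma_pos)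
  have "abundancy (n\<^sup>2) = 2 - 2 * (real s - 1) / (real q * real s)"
    unfolding s_def using assms by (intro abundancy_cofactor_perfect) simp_all
  then have "abundancy (n\<^sup>2) = 2 - 5 / (3 * real q)
      \<longleftrightarrow> 2 * (real s - 1) / (real q * real s) = 5 / (3 * real q)"
    by simp
  also have "\<dots> \<longleftrightarrow> s = Suc 5"
    using \<open>q > 0\<close> \<open>s > 0\<close> by (simp add: frac_eq_eq)
  also have "\<dots> \<longleftrightarrow> k = 1 \<and> q = 5"
    unfolding s_def using \<open>prime q\<close>
    by (intro divisor_sigma_prime_power_eq_Suc_prime_iff) simp_all
  finally show ?thesis .
qed

end
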